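(* Let $n\geq5$ be an integer with $n\equiv1\pmod 4$, and let $r=\frac{n-1}{2}$. Let $G$ be an $r$-regular graph on $n$ vertices. Then, for every real number $p>2$, $$\mathcal{E}_p(S(G)) \geq (n-1)\,n^{\frac p2}.$$ Equality holds if and only if $G$ is a conference graph. In particular, whenever $n$ is a prime power, the Paley graph $P(n)$ attains equality.
   Context: All graphs are finite, simple, undirected, non-empty and have at least one edge. A graph is $r$-regular if every vertex has degree $r$. For a graph $G$ with vertex set $\{v_1,\dots,v_n\}$, the Seidel matrix $S(G)$ is the real symmetric $n\times n$ matrix with zero diagonal whose $(i,j)$-entry, for $i\neq j$, is $-1$ if $v_i$ and $v_j$ are adjacent and $+1$ otherwise. If $\lambda_1,\dots,\lambda_n$ are the eigenvalues of $S(G)$ (with multiplicity), the $p$-Seidel energy is $\mathcal{E}_p(S(G))=\sum_{i=1}^n|\lambda_i|^p$ for $p>0$. A strongly regular graph with parameters $(n,k,\lambda,\mu)$ is a $k$-regular graph on $n$ vertices in which any two adjacent vertices have exactly $\lambda$ common neighbors and any two distinct non-adjacent vertices have exactly $\mu$ common neighbors. A conference graph of order $n$ is a strongly regular graph with parameters $\left(n,\frac{n-1}{2},\frac{n-5}{4},\frac{n-1}{4}\right)$. For a prime power $n\equiv1\pmod4$, the Paley graph $P(n)$ has vertex set the finite field $\mathbb{F}_n$ of order $n$, two distinct vertices $x,y$ being adjacent if and only if $x-y$ is a nonzero square in $\mathbb{F}_n$. *)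

theory Defs
  imports
    "HOL-Analysis.Analysis"
    "HOL-Algebra.Ring"
    "HOL-Number_Theory.Prime_Powers"
    "Graph_Theory.Pair_Digraph"
    "Jordan_Normal_Form.Char_Poly"
begin

text \<open>An undirected edge is represented by its two arcs, so \<open>(u, v) \<in> parcs G\<close> is adjacency and
  the out-degree of a vertex is its degree. A graph with an edge is in particular non-empty.\<close>

locale simple_graph = pair_graph G for G :: "'a pair_pre_digraph" +
  assumes has_edge: "parcs G \<noteq> {}"

definition regular_graph :: "'a pair_pre_digraph \<Rightarrow> nat \<Rightarrow> bool" where
  "regular_graph G r \<longleftrightarrow> simple_graph G \<and> (\<forall>v \<in> pverts G. out_degree (with_proj G) v = r)"

definition common_neighbours :: "'a pair_pre_digraph \<Rightarrow> 'a \<Rightarrow> 'a \<Rightarrow> 'a set" where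
  "common_neighbours G u v = {w \<in> pverts G. (u, w) \<in> parcs G \<and> (v, w) \<in> parcs G}"

definition strongly_regular_graph ::
  "'a pair_pre_digraph \<Rightarrow> nat \<Rightarrow> nat \<Rightarrow> nat \<Rightarrow> nat \<Rightarrow> bool" where
  "strongly_regular_graph G n k l m \<longleftrightarrow>
     regular_graph G k \<and> card (pverts G) = n \<and>
     (\<forall>u \<in> pverts G. \<forall>v \<in> pverts G. (u, v) \<in> parcs G \<longrightarrow> card (common_neighbours G u v) = l) \<and>
     (\<forall>u \<in> pverts G. \<forall>v \<in> pverts G. u \<noteq> v \<and> (u, v) \<notin> parcs G \<longrightarrow>
        card (common_neighbours G u v) = m)"

text \<open>The parameter equations are over the reals: the quotients have to be integers, which
  truncating division on natural numbers would not enforce.\<close>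

definition conference_graph :: "'a pair_pre_digraph \<Rightarrow> nat \<Rightarrow> bool" where
  "conference_graph G n \<longleftrightarrow>
     (\<exists>k l m. real k = (real n - 1) / 2 \<and> real l = (real n - 5) / 4 \<and> real m = (real n - 1) / 4 \<and>
        strongly_regular_graph G n k l m)"

definition vertex_enumeration :: "'a pair_pre_digraph \<Rightarrow> 'a list \<Rightarrow> bool" where
  "vertex_enumeration G vs \<longleftrightarrow> distinct vs \<and> set vs = pverts G"

definition seidel_matrix :: "'a pair_pre_digraph \<Rightarrow> 'a list \<Rightarrow> real mat" where
  "seidel_matrix G vs = mat (length vs) (length vs)
     (\<lambda>(i, j). if i = j then 0 else if (vs ! i, vs ! j) \<in> parcs G then -1 else 1)"

text \<open>The multiset of real eigenvalues with algebraic multiplicity. For a Seidel matrix these are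
  all the eigenvalues, see \<open>size_eigenvalues_seidel_matrix\<close> below.\<close>

definition eigenvalues :: "real mat \<Rightarrow> real multiset" where
  "eigenvalues A = proots (char_poly A)"

definition energy :: "real \<Rightarrow> real mat \<Rightarrow> real" where
  "energy p A = (\<Sum>x \<in># eigenvalues A. \<bar>x\<bar> powr p)"

definition paley_graph :: "('c, 'd) ring_scheme \<Rightarrow> 'c pair_pre_digraph" where
  "paley_graph F = \<lparr> pverts = carrier F,
     parcs = {(x, y). x \<in> carrier F \<and> y \<in> carrier F \<and> x \<noteq> y \<and>
       x \<ominus>\<^bsub>F\<^esub> y \<noteq> \<zero>\<^bsub>F\<^esub> \<and> (\<exists>z \<in> carrier F. x \<ominus>\<^bsub>F\<^esub> y = z \<otimes>\<^bsub>F\<^esub> z)} \<rparr>"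

lemma eigenvalue_symmetric_real:
  fixes A :: "real mat"
  assumes A: "A \<in> carrier_mat n n"
    and sym: "\<And>i j. i < n \<Longrightarrow> j < n \<Longrightarrow> A $$ (i, j) = A $$ (j, i)"
    and ev: "eigenvalue (map_mat complex_of_real A) z"
  shows "z \<in> \<real>"
proof -
  let ?C = "map_mat complex_of_real A"
  from ev obtain v where "eigenvector ?C v z" unfolding eigenvalue_def by blast
  with A have v: "v \<in> carrier_vec n" and v0: "v \<noteq> 0\<^sub>v n" and eq: "?C *\<^sub>v v = z \<cdot>\<^sub>v v"
    by (auto simp: eigenvector_def)
  have row: "(\<Sum>j<n. complex_of_real (A $$ (i, j)) * v $ j) = z * v $ i" if "i < n" for i
  proof -
    have "(?C *\<^sub>v v) $ i = z * v $ i" using eq that v by simp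
    then show ?thesis using that v A by (simp add: scalar_prod_def lessThan_atLeast0)
  qed
  define q where "q = (\<Sum>i<n. \<Sum>j<n. cnj (v $ i) * (complex_of_real (A $$ (i, j)) * v $ j))"
  define s where "s = (\<Sum>i<n. (cmod (v $ i))\<^sup>2)"
  have q: "q = z * complex_of_real s"
  proof -
    have "q = (\<Sum>i<n. cnj (v $ i) * (z * v $ i))"
      unfolding q_def by (intro sum.cong refl) (simp add: row flip: sum_distrib_left)
    also have "\<dots> = (\<Sum>i<n. z * complex_of_real ((cmod (v $ i))\<^sup>2))"
      by (intro sum.cong refl) (simp add: complex_norm_square mult_ac del: of_real_power)
    finally show ?thesis by (simp add: s_def sum_distrib_left)
  qed
  have "cnj q = (\<Sum>i<n. \<Sum>j<n. cnj (v $ j) * (complex_of_real (A $$ (j, i)) * v $ i))"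
    unfolding q_def cnj_sum by (intro sum.cong refl) (simp add: sym mult_ac)
  also have "\<dots> = q" unfolding q_def by (rule sum.swap)
  finally have "cnj q = q" .
  moreover have "s \<noteq> 0"
  proof
    assume "s = 0"
    then have "\<forall>i<n. v $ i = 0" unfolding s_def by (subst (asm) sum_nonneg_eq_0_iff) auto
    with v v0 show False by auto
  qed
  ultimately have "cnj z = z" using q by simp
  then show ?thesis by (simp add: Reals_cnj_iff)
qed

lemma size_proots_symmetric:
  fixes A :: "real mat"
  assumes A: "A \<in> carrier_mat n n"
    and sym: "\<And>i j. i < n \<Longrightarrow> j < n \<Longrightarrow> A $$ (i, j) = A $$ (j, i)"
  shows "size (proots (char_poly A)) = n"
proof -
  let ?C = "map_mat complex_of_real A"
  have C: "?C \<in> carrier_mat n n" using A by simp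
  from char_poly_factorized[OF C] obtain as
    where as: "char_poly ?C = (\<Prod>a\<leftarrow>as. [:- a, 1:])" and len: "length as = n" by blast
  have real: "a \<in> \<real>" if "a \<in> set as" for a
  proof (rule eigenvalue_symmetric_real[OF A sym])
    show "eigenvalue ?C a"
      unfolding eigenvalue_root_char_poly[OF C] as poly_prod_list
      using that by (auto simp: prod_list_zero_iff)
  qed
  define rs where "rs = map Re as"
  have as_rs: "as = map complex_of_real rs"
    unfolding rs_def map_map by (rule map_idI[symmetric]) (use real in auto)
  interpret H: map_poly_comm_ring_hom complex_of_real ..
  have "map_poly complex_of_real (char_poly A) = char_poly ?C"
    by (rule of_real_hom.char_poly_hom[OF A, symmetric])
  also have "\<dots> = (\<Prod>r\<leftarrow>rs. map_poly complex_of_real [:- r, 1:])"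
    by (simp add: as as_rs o_def)
  also have "\<dots> = map_poly complex_of_real (\<Prod>r\<leftarrow>rs. [:- r, 1:])"
    by (simp add: H.hom_prod_list o_def)
  finally have "char_poly A = (\<Prod>r\<leftarrow>rs. [:- r, 1:])"
    by (simp add: poly_eq_iff coeff_map_poly)
  moreover have "size (proots (\<Prod>r\<leftarrow>rs. [:- r, 1:])) = length rs"
  proof (induction rs)
    case (Cons r rs)
    have "(\<Prod>r\<leftarrow>rs. [:- r, 1:]) \<noteq> (0 :: real poly)" by (auto simp: prod_list_zero_iff)
    then show ?case using Cons by (simp add: proots_mult del: mult_pCons_left)
  qed simp
  ultimately show ?thesis using len by (simp add: rs_def)
qed

lemma size_eigenvalues_seidel_matrix:
  assumes "simple_graph G" and vs: "vertex_enumeration G vs"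
  shows "size (eigenvalues (seidel_matrix G vs)) = card (pverts G)"
proof -
  interpret simple_graph G by fact
  have "(a, b) \<in> parcs G \<Longrightarrow> (b, a) \<in> parcs G" for a b
    using pair_sym_arcs by (auto simp: symmetric_def dest: symD)
  then have "size (proots (char_poly (seidel_matrix G vs))) = length vs"
    by (intro size_proots_symmetric) (auto simp: seidel_matrix_def)
  with vs show ?thesis
    by (auto simp: eigenvalues_def vertex_enumeration_def distinct_card[symmetric])
qed

end

theory Submission
  imports
    Defs
    "Jordan_Normal_Form.Schur_Decomposition"
    "HOL-Algebra.Multiplicative_Group"
begin

text \<open>
  Write \<open>S\<close> for the Seidel matrix of an \<open>r\<close>-regular graph on \<open>n = 2 r + 1\<close> vertices, \<open>J\<close> for the
  all-ones matrix and \<open>I\<close> for the identity. Every row of \<open>S\<close> sums to \<open>n - 1 - 2 r = 0\<close>, so one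
  eigenvalue is \<open>0\<close>. The squares of the other \<open>n - 1\<close> eigenvalues add up to the trace of \<open>S\<^sup>2\<close>,
  which is \<open>n (n - 1)\<close>; their mean is \<open>n\<close>. As \<open>t \<mapsto> t powr (p / 2)\<close> is strictly convex for
  \<open>p > 2\<close>, the power mean inequality (\<open>power_mean_mset\<close>) gives the bound, with equality exactly when
  all these squares are equal to \<open>n\<close>.

  What equality means for the graph comes from a second moment that needs no diagonalisation: the
  sum of \<open>(x\<^sup>2 - n)\<^sup>2\<close> over the \<open>n - 1\<close> eigenvalues \<open>x\<close> is the sum of the squared entries of
  \<open>S\<^sup>2 - (n I - J)\<close>, because both sides are expressions in the traces of \<open>S\<^sup>2\<close> and \<open>S\<^sup>4\<close>
  (\<open>nontrivial_eigenvalues_moments\<close>). Hence equality holds exactly when \<open>S\<^sup>2 = n I - J\<close>, that is,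
  when any two distinct rows of \<open>S\<close> have inner product \<open>- 1\<close> (\<open>seidel_energy_bound\<close>). That inner
  product is determined by the adjacency and the number of common neighbours of the two vertices,
  and the value \<open>- 1\<close> prescribes the parameters of a conference graph
  (\<open>conference_graph_iff_orthogonal_seidel_rows\<close>).

  For a Paley graph the entries of \<open>S\<close> are \<open>- \<chi> (u - v)\<close> with the quadratic character \<open>\<chi>\<close>, so the
  inner products are the sums of \<open>\<chi> (w) \<chi> (w + c)\<close> over the field with \<open>c\<close> nonzero, and they have
  the value \<open>- 1\<close> (\<open>sum_quadratic_character_shift\<close>).
\<close>

section \<open>Power sums of eigenvalues\<close>

lemma monic_splits_proots:
  fixes p :: "'a::field poly"
  assumes "monic p" "size (proots p) = degree p"
  shows "p = (\<Prod>x\<in>#proots p. [:- x, 1:])"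
  using assms
proof (induction "degree p" arbitrary: p)
  case 0
  then have "p = 1" by (simp add: monic_degree_0)
  then show ?case by simp
next
  case (Suc d)
  then obtain x where x: "x \<in># proots p" by (metis multiset_nonemptyE size_empty nat.simps(3))
  have p0: "p \<noteq> 0" using Suc.prems by auto
  with x have "poly p x = 0" by simp
  then obtain q where q: "p = [:- x, 1:] * q" by (auto simp: poly_eq_0_iff_dvd elim: dvdE)
  then have q0: "q \<noteq> 0" using p0 by auto
  have pq: "proots p = add_mset x (proots q)"
    unfolding q by (subst proots_mult) (use q0 in simp_all)
  have dq: "degree p = Suc (degree q)" unfolding q by (subst degree_mult_eq) (use q0 in auto)
  have mq: "monic q" using Suc.prems(1) unfolding q by (simp add: lead_coeff_mult del: mult_pCons_left)
  have "q = (\<Prod>x\<in>#proots q. [:- x, 1:])"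
    using Suc.hyps(2) Suc.prems(2) dq pq mq by (intro Suc.hyps(1)) auto
  then show ?case using q pq by simp
qed

lemma trace_mult_commute:
  fixes A B :: "'a::comm_semiring_0 mat"
  assumes A: "A \<in> carrier_mat n m" and B: "B \<in> carrier_mat m n"
  shows "sum_list (diag_mat (A * B)) = sum_list (diag_mat (B * A))"
proof -
  have "sum_list (diag_mat (A * B)) = (\<Sum>i<n. \<Sum>j<m. A $$ (i, j) * B $$ (j, i))"
    using A B by (simp add: diag_mat_def scalar_prod_def lessThan_atLeast0 interv_sum_list_conv_sum_set_nat)
  also have "\<dots> = (\<Sum>j<m. \<Sum>i<n. B $$ (j, i) * A $$ (i, j))"
    by (subst sum.swap) (simp add: mult.commute)
  also have "\<dots> = sum_list (diag_mat (B * A))"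
    using A B by (simp add: diag_mat_def scalar_prod_def lessThan_atLeast0 interv_sum_list_conv_sum_set_nat)
  finally show ?thesis .
qed

lemma upper_triangular_mult:
  fixes A B :: "'a::semiring_0 mat"
  assumes A: "A \<in> carrier_mat n n" "upper_triangular A"
    and B: "B \<in> carrier_mat n n" "upper_triangular B"
  shows "upper_triangular (A * B)"
    and "i < n \<Longrightarrow> (A * B) $$ (i, i) = A $$ (i, i) * B $$ (i, i)"
proof -
  have *: "(A * B) $$ (i, j) = (\<Sum>k<n. A $$ (i, k) * B $$ (k, j))" if "i < n" "j < n" for i j
    using A B that by (simp add: scalar_prod_def lessThan_atLeast0)
  have zero: "A $$ (i, k) * B $$ (k, j) = 0" if "i < n" "k < n" "k < i \<or> j < k" for i j k
    using A B that by (auto simp: upper_triangular_def)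
  show "upper_triangular (A * B)"
  proof (rule upper_triangularI)
    fix i j assume "j < i" "i < dim_row (A * B)"
    then show "(A * B) $$ (i, j) = 0"
      using A by (subst *) (auto intro!: sum.neutral zero)
  qed
  show "(A * B) $$ (i, i) = A $$ (i, i) * B $$ (i, i)" if "i < n"
  proof -
    have "(A * B) $$ (i, i) = (\<Sum>k\<in>{i}. A $$ (i, k) * B $$ (k, i))"
      unfolding *[OF that that] using that
      by (intro sum.mono_neutral_right) (auto intro!: zero simp: linorder_neq_iff)
    then show ?thesis by simp
  qed
qed

lemma upper_triangular_pow:
  fixes A :: "'a::semiring_1 mat"
  assumes A: "A \<in> carrier_mat n n" "upper_triangular A"
  shows "upper_triangular (A ^\<^sub>m k)"
    and "diag_mat (A ^\<^sub>m k) = map (\<lambda>x. x ^ k) (diag_mat A)"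
proof -
  have "upper_triangular (A ^\<^sub>m k) \<and> (\<forall>i<n. (A ^\<^sub>m k) $$ (i, i) = (A $$ (i, i)) ^ k)"
  proof (induction k)
    case 0
    then show ?case using A by simp
  next
    case (Suc k)
    then show ?case
      using A upper_triangular_mult[OF pow_carrier_mat[OF A(1), of k] _ A]
      by (simp add: power_commutes)
  qed
  then show "upper_triangular (A ^\<^sub>m k)" "diag_mat (A ^\<^sub>m k) = map (\<lambda>x. x ^ k) (diag_mat A)"
    using A by (auto simp: diag_mat_def)
qed

text \<open>The hypothesis on the roots says that the characteristic polynomial splits, so Schur's theorem
  makes \<open>A\<close> similar to an upper triangular matrix with the eigenvalues on its diagonal. Powers act
  entrywise on that diagonal, and similarity preserves the trace.\<close>

lemma trace_pow_eq_power_sum: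
  fixes A :: "'a::conjugatable_ordered_field mat"
  assumes A: "A \<in> carrier_mat n n" and n: "size (proots (char_poly A)) = n"
  shows "sum_list (diag_mat (A ^\<^sub>m k)) = (\<Sum>x\<in>#proots (char_poly A). x ^ k)"
proof -
  obtain es where es: "mset es = proots (char_poly A)" by (metis ex_mset)
  have "char_poly A = (\<Prod>x\<in>#proots (char_poly A). [:- x, 1:])"
    using degree_monic_char_poly[OF A] n by (intro monic_splits_proots) auto
  then have cp: "char_poly A = (\<Prod>x\<leftarrow>es. [:- x, 1:])"
    unfolding es[symmetric] by (simp flip: prod_mset_prod_list)
  obtain B P Q where "schur_decomposition A es = (B, P, Q)" by (metis prod_cases3)
  from schur_decomposition[OF A cp this]
  have wit: "similar_mat_wit A B P Q" and B: "upper_triangular B" "diag_mat B = es" by auto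
  from similar_mat_witD2[OF A wit]
  have QP: "Q * P = 1\<^sub>m n" and [simp]: "B \<in> carrier_mat n n" "P \<in> carrier_mat n n" "Q \<in> carrier_mat n n"
    by auto
  have Bk[simp]: "B ^\<^sub>m k \<in> carrier_mat n n" by simp
  have "sum_list (diag_mat (A ^\<^sub>m k)) = sum_list (diag_mat (P * (B ^\<^sub>m k * Q)))"
    by (simp add: similar_mat_wit_pow_id[OF wit] assoc_mult_mat[where n\<^sub>1=n and n\<^sub>2=n and n\<^sub>3=n and n\<^sub>4=n])
  also have "\<dots> = sum_list (diag_mat (B ^\<^sub>m k * Q * P))"
    by (rule trace_mult_commute[where n=n and m=n]) (auto intro!: mult_carrier_mat[where n=n])
  also have "B ^\<^sub>m k * Q * P = B ^\<^sub>m k"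
    using right_mult_one_mat[OF Bk]
    by (simp add: QP assoc_mult_mat[where n\<^sub>1=n and n\<^sub>2=n and n\<^sub>3=n and n\<^sub>4=n])
  also have "sum_list (diag_mat (B ^\<^sub>m k)) = (\<Sum>x\<leftarrow>es. x ^ k)"
    by (subst upper_triangular_pow(2)[where n=n]) (simp_all add: B)
  also have "\<dots> = (\<Sum>x\<in>#mset es. x ^ k)" by (simp flip: sum_mset_sum_list)
  finally show ?thesis by (simp add: es)
qed

lemma trace_pow2_symmetric:
  fixes A :: "'a::comm_semiring_1 mat"
  assumes A: "A \<in> carrier_mat n n"
    and sym: "\<And>i j. i < n \<Longrightarrow> j < n \<Longrightarrow> A $$ (i, j) = A $$ (j, i)"
  shows "sum_list (diag_mat (A * A)) = (\<Sum>i<n. \<Sum>j<n. (A $$ (i, j))\<^sup>2)"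
proof -
  have "sum_list (diag_mat (A * A)) = (\<Sum>i<n. \<Sum>j<n. A $$ (i, j) * A $$ (j, i))"
    using A by (simp add: diag_mat_def scalar_prod_def lessThan_atLeast0 interv_sum_list_conv_sum_set_nat)
  also have "\<dots> = (\<Sum>i<n. \<Sum>j<n. (A $$ (i, j))\<^sup>2)"
    by (intro sum.cong refl) (simp add: sym power2_eq_square)
  finally show ?thesis .
qed

section \<open>Symmetric matrices with zero row sums and unit entries off the diagonal\<close>

lemma eigenvalue_zero_of_row_sums_zero:
  fixes A :: "real mat"
  assumes A: "A \<in> carrier_mat n n" and "0 < n"
    and rows: "\<And>i. i < n \<Longrightarrow> (\<Sum>j<n. A $$ (i, j)) = 0"
  shows "0 \<in># proots (char_poly A)"
proof -
  define v where "v = vec n (\<lambda>_. 1 :: real)"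
  have "vec_index v 0 \<noteq> vec_index (0\<^sub>v n) 0" using \<open>0 < n\<close> by (simp add: v_def)
  then have "v \<noteq> 0\<^sub>v n" by auto
  moreover have "A *\<^sub>v v = 0 \<cdot>\<^sub>v v"
    using A rows by (intro eq_vecI) (auto simp: v_def scalar_prod_def lessThan_atLeast0)
  ultimately have "eigenvalue A 0"
    using A by (auto simp: eigenvalue_def eigenvector_def v_def intro!: exI[of _ v])
  then have "poly (char_poly A) 0 = 0" using eigenvalue_root_char_poly[OF A] by simp
  moreover have "char_poly A \<noteq> 0" using degree_monic_char_poly[OF A] by auto
  ultimately show ?thesis by simp
qed

text \<open>The last sum is the squared Frobenius norm of \<open>S\<^sup>2 - (n I - J)\<close>. Its expansion has three parts:
  the trace of \<open>S\<^sup>4\<close>, the cross term in which the sum of all entries of \<open>S\<^sup>2\<close> vanishes with the row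
  sums of \<open>S\<close> while the diagonal of \<open>S\<^sup>2\<close> is constantly \<open>n - 1\<close>, and a constant. The left side
  expands to the same quantities through the second and fourth power sums, which the removed
  eigenvalue \<open>0\<close> leaves unchanged.\<close>

lemma nontrivial_eigenvalues_moments:
  fixes S :: "real mat"
  assumes S: "S \<in> carrier_mat n n" and n: "0 < n"
    and sym: "\<And>i j. i < n \<Longrightarrow> j < n \<Longrightarrow> S $$ (i, j) = S $$ (j, i)"
    and rows: "\<And>i. i < n \<Longrightarrow> (\<Sum>j<n. S $$ (i, j)) = 0"
    and entries: "\<And>i j. i < n \<Longrightarrow> j < n \<Longrightarrow> (S $$ (i, j))\<^sup>2 = (if i = j then 0 else 1)"
  obtains E where "eigenvalues S = add_mset 0 E" "size E = n - 1"
    "(\<Sum>x\<in>#E. x\<^sup>2) = real (n - 1) * real n"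
    "(\<Sum>x\<in>#E. (x\<^sup>2 - real n)\<^sup>2) =
      (\<Sum>i<n. \<Sum>j<n. ((\<Sum>k<n. S $$ (i, k) * S $$ (j, k)) - (if i = j then real n - 1 else - 1))\<^sup>2)"
proof -
  define E where "E = eigenvalues S - {#0#}"
  have ev: "eigenvalues S = add_mset 0 E"
    using eigenvalue_zero_of_row_sums_zero[OF S n rows] by (simp add: E_def eigenvalues_def)
  have size: "size (proots (char_poly S)) = n" by (rule size_proots_symmetric[OF S sym])
  then have sizeE: "size E = n - 1" using ev by (simp add: eigenvalues_def)
  have power_sum: "(\<Sum>x\<in>#E. x ^ k) = sum_list (diag_mat (S ^\<^sub>m k))" if "0 < k" for k
    using trace_pow_eq_power_sum[OF S size, of k] ev that by (simp add: eigenvalues_def)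
  have SS: "S * S \<in> carrier_mat n n" using S by simp
  have sq: "(S * S) $$ (i, j) = (\<Sum>k<n. S $$ (i, k) * S $$ (j, k))" if "i < n" "j < n" for i j
    using S that by (auto simp: scalar_prod_def lessThan_atLeast0 sym intro!: sum.cong)
  have symSS: "(S * S) $$ (i, j) = (S * S) $$ (j, i)" if "i < n" "j < n" for i j
    unfolding sq[OF that] sq[OF that(2,1)] by (simp add: mult.commute)
  have pow2: "S ^\<^sub>m 2 = S * S" and pow4: "S ^\<^sub>m 4 = (S * S) * (S * S)"
    using S by (simp_all add: numeral_eq_Suc assoc_mult_mat[where n\<^sub>1=n and n\<^sub>2=n and n\<^sub>3=n and n\<^sub>4=n])
  have row: "(\<Sum>j<n. (if i = j then 0 else 1 :: real)) = real n - 1" if "i < n" for i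
  proof -
    have "(\<Sum>j<n. (if i = j then 0 else 1 :: real)) = (\<Sum>j<n. 1 - (if i = j then 1 else 0))"
      by (intro sum.cong) auto
    also have "\<dots> = real n - 1" using that by (simp add: sum_subtractf)
    finally show ?thesis .
  qed
  have second: "(\<Sum>x\<in>#E. x\<^sup>2) = real n * (real n - 1)"
  proof -
    have "(\<Sum>x\<in>#E. x\<^sup>2) = (\<Sum>i<n. \<Sum>j<n. (S $$ (i, j))\<^sup>2)"
      by (simp add: power_sum pow2 trace_pow2_symmetric[OF S sym])
    also have "\<dots> = (\<Sum>i<n. real n - 1)" by (intro sum.cong refl) (simp add: entries row)
    finally show ?thesis by simp
  qed
  have diag: "(S * S) $$ (i, i) = real n - 1" if "i < n" for i
    using entries row that by (simp add: sq power2_eq_square)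
  have total: "(\<Sum>i<n. \<Sum>j<n. (S * S) $$ (i, j)) = 0"
  proof -
    have "(\<Sum>i<n. \<Sum>j<n. (S * S) $$ (i, j)) = (\<Sum>i<n. \<Sum>k<n. S $$ (i, k) * (\<Sum>j<n. S $$ (k, j)))"
    proof (rule sum.cong[OF refl])
      fix i assume "i \<in> {..<n}"
      then have "(\<Sum>j<n. (S * S) $$ (i, j)) = (\<Sum>j<n. \<Sum>k<n. S $$ (i, k) * S $$ (k, j))"
        by (intro sum.cong refl) (auto simp: sq sym)
      also have "\<dots> = (\<Sum>k<n. S $$ (i, k) * (\<Sum>j<n. S $$ (k, j)))"
        by (subst sum.swap) (simp add: sum_distrib_left)
      finally show "(\<Sum>j<n. (S * S) $$ (i, j)) = (\<Sum>k<n. S $$ (i, k) * (\<Sum>j<n. S $$ (k, j)))" .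
    qed
    also have "\<dots> = 0" by (simp add: rows)
    finally show ?thesis .
  qed
  have "(\<Sum>x\<in>#E. (x\<^sup>2 - real n)\<^sup>2) = (\<Sum>x\<in>#E. x ^ 4 - 2 * real n * x\<^sup>2 + (real n)\<^sup>2)"
    by (intro arg_cong[where f = sum_mset] image_mset_cong) (simp add: power2_diff power_mult[symmetric])
  also have "\<dots> = (\<Sum>x\<in>#E. x ^ 4) - 2 * real n * (\<Sum>x\<in>#E. x\<^sup>2) + real (size E) * (real n)\<^sup>2"
    by (induction E) (simp_all add: algebra_simps)
  also have "\<dots> = (\<Sum>x\<in>#E. x ^ 4) - (real n)\<^sup>2 * (real n - 1)"
    using n by (simp add: second sizeE of_nat_diff) (simp add: algebra_simps power2_eq_square)
  also have "(\<Sum>x\<in>#E. x ^ 4) = (\<Sum>i<n. \<Sum>j<n. ((S * S) $$ (i, j))\<^sup>2)"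
    by (simp add: power_sum pow4 trace_pow2_symmetric[OF SS symSS])
  also have "\<dots> - (real n)\<^sup>2 * (real n - 1) =
      (\<Sum>i<n. \<Sum>j<n. ((S * S) $$ (i, j) - (if i = j then real n - 1 else - 1))\<^sup>2)"
  proof -
    (* The summand off the diagonal is used on it as well, corrected by a term that is constant
       because the diagonal entries of S * S are known. *)
    have "(\<Sum>i<n. \<Sum>j<n. ((S * S) $$ (i, j) - (if i = j then real n - 1 else - 1))\<^sup>2) =
        (\<Sum>i<n. \<Sum>j<n. ((S * S) $$ (i, j))\<^sup>2 + 2 * (S * S) $$ (i, j)
          + (if i = j then (real n - 1)\<^sup>2 - 2 * real n * (real n - 1) - 1 else 0) + 1)"
      by (intro sum.cong refl) (auto simp: diag power2_eq_square algebra_simps)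
    also have "\<dots> = (\<Sum>i<n. \<Sum>j<n. ((S * S) $$ (i, j))\<^sup>2) + 2 * (\<Sum>i<n. \<Sum>j<n. (S * S) $$ (i, j))
        + real n * ((real n - 1)\<^sup>2 - 2 * real n * (real n - 1) - 1) + real n * real n"
      by (simp add: sum.distrib sum_distrib_left)
    finally show ?thesis using total by (simp add: power2_eq_square algebra_simps)
  qed
  also have "\<dots> = (\<Sum>i<n. \<Sum>j<n.
      ((\<Sum>k<n. S $$ (i, k) * S $$ (j, k)) - (if i = j then real n - 1 else - 1))\<^sup>2)"
    by (intro sum.cong refl) (simp add: sq)
  finally show ?thesis using that[OF ev sizeE] second n by (simp add: of_nat_diff mult.commute)
qed

section \<open>The power mean inequality\<close>

text \<open>Bernoulli's inequality with a real exponent, strict away from \<open>t = 1\<close>. With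
  \<open>u = 1 + q (t - 1)\<close>, the number \<open>t\<close> is the convex combination \<open>u / q + (1 - 1 / q)\<close> of \<open>u\<close> and \<open>1\<close>,
  so the claim is \<open>ln u \<le> q ln t\<close>, which is concavity of the logarithm. It follows from
  \<open>ln x \<le> x - 1\<close> at \<open>x = u / t\<close> and, strictly, at \<open>x = 1 / t\<close>. When \<open>u \<le> 0\<close> the sign of the two
  sides decides.\<close>

lemma powr_tangent_at_one:
  fixes t q :: real
  assumes t: "0 \<le> t" and q: "1 < q"
  shows "1 + q * (t - 1) \<le> t powr q"
    and "t powr q = 1 + q * (t - 1) \<longleftrightarrow> t = 1"
proof -
  have "1 + q * (t - 1) < t powr q" if "t \<noteq> 1"
  proof (cases "1 + q * (t - 1) > 0 \<and> t > 0")
    case True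
    define u where "u = 1 + q * (t - 1)"
    have u: "u > 0" and t: "t > 0" using True by (auto simp: u_def)
    have "ln (u / t) \<le> u / t - 1" using u t by (intro ln_le_minus_one) simp
    moreover have "ln (1 / t) < 1 / t - 1"
      using t that ln_le_minus_one[of "1 / t"] ln_eq_minus_one[of "1 / t"] by force
    ultimately have "ln u - ln t + (q - 1) * (- ln t) < u / t - 1 + (q - 1) * (1 / t - 1)"
      using q u t by (intro add_le_less_mono mult_strict_left_mono) (simp_all add: ln_div)
    also have "\<dots> = 0" using t by (simp add: u_def field_simps)
    finally have "ln u < q * ln t" by (simp add: algebra_simps)
    also have "\<dots> = ln (t powr q)" using t by (simp add: ln_powr)
    finally have "u < t powr q" using u t by (subst (asm) ln_less_cancel_iff) auto
    then show ?thesis by (simp add: u_def)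
  next
    case False
    then show ?thesis
    proof (cases "t = 0")
      case True
      then show ?thesis using q by simp
    next
      case nz: False
      then have "1 + q * (t - 1) \<le> 0" using False t by auto
      moreover have "t powr q > 0" using nz by simp
      ultimately show ?thesis by linarith
    qed
  qed
  then show "1 + q * (t - 1) \<le> t powr q" "t powr q = 1 + q * (t - 1) \<longleftrightarrow> t = 1"
    by (cases "t = 1"; force)+
qed

lemma sum_mset_nonneg:
  fixes f :: "'b \<Rightarrow> 'a::ordered_comm_monoid_add"
  assumes "\<And>x. x \<in># M \<Longrightarrow> 0 \<le> f x"
  shows "0 \<le> (\<Sum>x\<in>#M. f x)"
    and "(\<Sum>x\<in>#M. f x) = 0 \<longleftrightarrow> (\<forall>x\<in>#M. f x = 0)"
  using assms by (induction M) (auto simp: add_nonneg_eq_0_iff)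

text \<open>Each \<open>\<bar>x\<bar> powr p = (x\<^sup>2) powr (p / 2)\<close> lies above the tangent at \<open>x\<^sup>2 = N\<close>. The linear terms of
  the tangents cancel in the sum because \<open>N\<close> is the mean of the squares, so the sum of the gaps is
  the difference of the two sides.\<close>

lemma power_mean_mset:
  fixes E :: "real multiset"
  assumes p: "2 < p" and N: "0 < N" and sq: "(\<Sum>x\<in>#E. x\<^sup>2) = real (size E) * N"
  shows "real (size E) * N powr (p / 2) \<le> (\<Sum>x\<in>#E. \<bar>x\<bar> powr p)"
    and "(\<Sum>x\<in>#E. \<bar>x\<bar> powr p) = real (size E) * N powr (p / 2) \<longleftrightarrow> (\<forall>x\<in>#E. x\<^sup>2 = N)"
proof -
  define gap where "gap x = \<bar>x\<bar> powr p - N powr (p / 2) * (1 + p / 2 * (x\<^sup>2 / N - 1))" for x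
  have pow: "\<bar>x\<bar> powr p = N powr (p / 2) * (x\<^sup>2 / N) powr (p / 2)" for x
  proof -
    have "\<bar>x\<bar> powr p = (\<bar>x\<bar> powr 2) powr (p / 2)" by (simp only: powr_powr) simp
    also have "\<bar>x\<bar> powr 2 = N * (x\<^sup>2 / N)" using N by (cases "x = 0") (simp_all add: powr_numeral)
    finally show ?thesis using N powr_mult[of N "x\<^sup>2 / N" "p / 2"] by simp
  qed
  have gap: "gap x = N powr (p / 2) * ((x\<^sup>2 / N) powr (p / 2) - (1 + p / 2 * (x\<^sup>2 / N - 1)))" for x
    unfolding gap_def pow by (simp add: right_diff_distrib)
  have tangent: "1 + p / 2 * (x\<^sup>2 / N - 1) \<le> (x\<^sup>2 / N) powr (p / 2)"
    "(x\<^sup>2 / N) powr (p / 2) = 1 + p / 2 * (x\<^sup>2 / N - 1) \<longleftrightarrow> x\<^sup>2 / N = 1" for x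
    using p N by (intro powr_tangent_at_one; simp)+
  have gap_nonneg: "0 \<le> gap x" for x unfolding gap using tangent(1)[of x] by simp
  have gap_zero: "gap x = 0 \<longleftrightarrow> x\<^sup>2 = N" for x
    using tangent(2)[of x] N by (auto simp: gap)
  have "(\<Sum>x\<in>#E. \<bar>x\<bar> powr p) = (\<Sum>x\<in>#E. gap x)
      + N powr (p / 2) * (real (size E) + p / 2 * ((\<Sum>x\<in>#E. x\<^sup>2) / N - real (size E)))"
    by (induction E) (simp_all add: gap_def algebra_simps add_divide_distrib)
  also have "\<dots> = (\<Sum>x\<in>#E. gap x) + real (size E) * N powr (p / 2)"
    using N by (simp add: sq)
  finally have sum: "(\<Sum>x\<in>#E. \<bar>x\<bar> powr p) = (\<Sum>x\<in>#E. gap x) + real (size E) * N powr (p / 2)" .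
  show "real (size E) * N powr (p / 2) \<le> (\<Sum>x\<in>#E. \<bar>x\<bar> powr p)"
    unfolding sum using sum_mset_nonneg(1)[of E gap] gap_nonneg by simp
  show "(\<Sum>x\<in>#E. \<bar>x\<bar> powr p) = real (size E) * N powr (p / 2) \<longleftrightarrow> (\<forall>x\<in>#E. x\<^sup>2 = N)"
    unfolding sum using sum_mset_nonneg(2)[of E gap] gap_nonneg by (simp add: gap_zero)
qed

section \<open>Seidel matrices of regular graphs\<close>

text \<open>The Seidel matrix indexed by vertices instead of by positions in an enumeration.\<close>

definition seidel :: "'a pair_pre_digraph \<Rightarrow> 'a \<Rightarrow> 'a \<Rightarrow> real" where
  "seidel G u v = (if u = v then 0 else if (u, v) \<in> parcs G then - 1 else 1)"

text \<open>This is \<open>S\<^sup>2 = n I - J\<close> off the diagonal. The diagonal of \<open>S\<^sup>2\<close> is \<open>n - 1\<close> for every Seidel matrix.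
  Equivalently, the rows of \<open>S\<close> extended by a column of ones are orthogonal.\<close>

definition orthogonal_seidel_rows :: "'a pair_pre_digraph \<Rightarrow> bool" where
  "orthogonal_seidel_rows G \<longleftrightarrow> (\<forall>u\<in>pverts G. \<forall>v\<in>pverts G. u \<noteq> v \<longrightarrow>
     (\<Sum>w\<in>pverts G. seidel G u w * seidel G v w) = - 1)"

lemma seidel_eq_adjacency:
  assumes "(u, u) \<notin> parcs G"
  shows "seidel G u v = 1 - of_bool (u = v) - 2 * of_bool ((u, v) \<in> parcs G)"
  using assms by (auto simp: seidel_def)

lemma (in pair_wf_digraph) out_degree_eq_card_neighbours:
  "out_degree (with_proj G) u = card {v \<in> pverts G. (u, v) \<in> parcs G}"
proof -
  have "out_arcs (with_proj G) u = Pair u ` {v \<in> pverts G. (u, v) \<in> parcs G}"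
    by (auto simp: out_arcs_def dest: in_arcsD2)
  then show ?thesis by (simp add: out_degree_def card_image inj_on_def)
qed

lemma regular_graphD:
  assumes "regular_graph G r"
  shows "finite (pverts G)" "(u, u) \<notin> parcs G"
    "(u, v) \<in> parcs G \<Longrightarrow> (v, u) \<in> parcs G"
    "u \<in> pverts G \<Longrightarrow> card {v \<in> pverts G. (u, v) \<in> parcs G} = r"
proof -
  interpret simple_graph G using assms by (simp add: regular_graph_def)
  show "finite (pverts G)" by (rule pair_finite_verts)
  show "(u, u) \<notin> parcs G" using pair_no_loops by fastforce
  show "(v, u) \<in> parcs G" if "(u, v) \<in> parcs G"
    using pair_sym_arcs that by (auto simp: symmetric_def dest: symD)
  assume u: "u \<in> pverts G"
  then show "card {v \<in> pverts G. (u, v) \<in> parcs G} = r"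
    using assms by (simp add: regular_graph_def flip: out_degree_eq_card_neighbours)
qed

lemma sum_seidel_row:
  assumes G: "regular_graph G r" and u: "u \<in> pverts G"
  shows "(\<Sum>v\<in>pverts G. seidel G u v) = real (card (pverts G)) - 1 - 2 * real r"
proof -
  note D = regular_graphD[OF G]
  have "(\<Sum>v\<in>pverts G. of_bool (u = v) :: real) = 1"
    using D(1) u by (simp add: of_bool_def)
  moreover have "(\<Sum>v\<in>pverts G. of_bool ((u, v) \<in> parcs G) :: real) = real r"
    using D(1) D(4)[OF u] by (simp add: Int_def)
  ultimately show ?thesis
    by (simp add: seidel_eq_adjacency[OF D(2)] sum_subtractf flip: sum_distrib_left)
qed

text \<open>With \<open>A\<close> the adjacency matrix, this is the entry of \<open>(J - I - 2 A)\<^sup>2\<close> at \<open>(u, v)\<close>; the common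
  neighbours are counted by \<open>A\<^sup>2\<close>.\<close>

lemma sum_seidel_rows_product:
  assumes G: "regular_graph G r" and u: "u \<in> pverts G" and v: "v \<in> pverts G" and "u \<noteq> v"
  shows "(\<Sum>w\<in>pverts G. seidel G u w * seidel G v w) =
    real (card (pverts G)) - 2 - 4 * real r + 4 * of_bool ((u, v) \<in> parcs G)
      + 4 * real (card (common_neighbours G u v))"
proof -
  note D = regular_graphD[OF G]
  let ?e = "\<lambda>x y. of_bool (x = y) :: real"
  let ?a = "\<lambda>x y. of_bool ((x, y) \<in> parcs G) :: real"
  have vu: "(v, u) \<in> parcs G \<longleftrightarrow> (u, v) \<in> parcs G" using D(3) by blast
  have "seidel G u w * seidel G v w = 1 - ?e u w - ?e v w - 2 * ?a u w - 2 * ?a v w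
      + ?e u w * (2 * ?a u v) + ?e v w * (2 * ?a u v)
      + 4 * of_bool ((u, w) \<in> parcs G \<and> (v, w) \<in> parcs G)" for w
    using \<open>u \<noteq> v\<close> D(2)[of u] D(2)[of v] vu by (auto simp: seidel_def)
  then have "(\<Sum>w\<in>pverts G. seidel G u w * seidel G v w) =
      real (card (pverts G)) - (\<Sum>w\<in>pverts G. ?e u w) - (\<Sum>w\<in>pverts G. ?e v w)
      - 2 * (\<Sum>w\<in>pverts G. ?a u w) - 2 * (\<Sum>w\<in>pverts G. ?a v w)
      + (\<Sum>w\<in>pverts G. ?e u w) * (2 * ?a u v) + (\<Sum>w\<in>pverts G. ?e v w) * (2 * ?a u v)
      + 4 * (\<Sum>w\<in>pverts G. of_bool ((u, w) \<in> parcs G \<and> (v, w) \<in> parcs G))"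
    by (simp only: sum.distrib sum_subtractf sum_distrib_left[symmetric] sum_distrib_right[symmetric]) simp
  moreover have "(\<Sum>w\<in>pverts G. ?e x w) = 1" if "x \<in> pverts G" for x
    using D(1) that by (simp add: of_bool_def)
  moreover have "(\<Sum>w\<in>pverts G. ?a x w) = real r" if "x \<in> pverts G" for x
    using D(1) D(4)[OF that] by (simp add: Int_def)
  moreover have "(\<Sum>w\<in>pverts G. of_bool ((u, w) \<in> parcs G \<and> (v, w) \<in> parcs G) :: real) =
      real (card (common_neighbours G u v))"
    using D(1) by (simp add: Int_def common_neighbours_def)
  ultimately show ?thesis using u v by simp
qed

text \<open>For \<open>n = 4 m + 1\<close> and \<open>r = 2 m\<close> the inner product of two rows is \<open>- 1\<close> exactly when the two
  vertices have \<open>m - 1\<close> common neighbours if adjacent and \<open>m\<close> if not. These numbers are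
  \<open>(n - 5) / 4\<close> and \<open>(n - 1) / 4\<close>.\<close>

lemma conference_graph_iff_orthogonal_seidel_rows:
  assumes G: "regular_graph G r" and card: "card (pverts G) = n" and n: "n = 2 * r + 1" "n mod 4 = 1"
    and "5 \<le> n"
  shows "conference_graph G n \<longleftrightarrow> orthogonal_seidel_rows G"
proof -
  obtain m where m: "n = 4 * m + 1" "r = 2 * m" "1 \<le> m"
  proof
    show "n = 4 * (n div 4) + 1" "r = 2 * (n div 4)" "1 \<le> n div 4" using n \<open>5 \<le> n\<close> by presburger+
  qed
  have product: "(\<Sum>w\<in>pverts G. seidel G u w * seidel G v w) = - 1 \<longleftrightarrow>
      card (common_neighbours G u v) = (if (u, v) \<in> parcs G then m - 1 else m)"
    if "u \<in> pverts G" "v \<in> pverts G" "u \<noteq> v" for u v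
    unfolding sum_seidel_rows_product[OF G that] card using m by (auto simp: of_nat_diff)
  have "conference_graph G n \<longleftrightarrow> strongly_regular_graph G n r (m - 1) m"
  proof -
    have "real k = (real n - 1) / 2 \<longleftrightarrow> k = r" "real k = (real n - 5) / 4 \<longleftrightarrow> k = m - 1"
      "real k = (real n - 1) / 4 \<longleftrightarrow> k = m" for k
      using m by (auto simp: of_nat_diff field_simps)
    then show ?thesis by (simp add: conference_graph_def)
  qed
  also have "\<dots> \<longleftrightarrow> orthogonal_seidel_rows G"
  proof -
    have "strongly_regular_graph G n r (m - 1) m \<longleftrightarrow> (\<forall>u\<in>pverts G. \<forall>v\<in>pverts G. u \<noteq> v \<longrightarrow>
        card (common_neighbours G u v) = (if (u, v) \<in> parcs G then m - 1 else m))"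
      using regular_graphD(2)[OF G] by (auto simp: strongly_regular_graph_def G card)
    also have "\<dots> \<longleftrightarrow> orthogonal_seidel_rows G"
      unfolding orthogonal_seidel_rows_def by (intro ball_cong refl imp_cong) (simp add: product)
    finally show ?thesis .
  qed
  finally show ?thesis .
qed

text \<open>Equality in the power mean inequality is the vanishing of all \<open>(x\<^sup>2 - n)\<^sup>2\<close>, hence of their sum,
  which is a sum of squares over the entries of \<open>S\<^sup>2 - (n I - J)\<close>.\<close>

lemma seidel_energy_bound:
  assumes G: "regular_graph G r" and card: "card (pverts G) = n" and n: "n = 2 * r + 1" "1 < n"
    and vs: "vertex_enumeration G vs" and p: "2 < p"
  shows "(real n - 1) * real n powr (p / 2) \<le> energy p (seidel_matrix G vs)"
    and "energy p (seidel_matrix G vs) = (real n - 1) * real n powr (p / 2) \<longleftrightarrow>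
      orthogonal_seidel_rows G"
proof -
  note D = regular_graphD[OF G]
  let ?S = "seidel_matrix G vs"
  have vs': "distinct vs" "set vs = pverts G" using vs by (auto simp: vertex_enumeration_def)
  then have len: "length vs = n" using card distinct_card by fastforce
  have S: "?S \<in> carrier_mat n n" by (simp add: seidel_matrix_def len)
  have entry: "?S $$ (i, j) = seidel G (vs ! i) (vs ! j)" if "i < n" "j < n" for i j
    using that vs' by (simp add: seidel_matrix_def seidel_def len nth_eq_iff_index_eq)
  have nth: "vs ! i \<in> pverts G" if "i < n" for i
    using that len nth_mem[of i vs] unfolding vs'(2) by simp
  have bij: "bij_betw ((!) vs) {..<n} (pverts G)"
    by (rule bij_betw_nth) (simp_all only: vs' len)
  have sum_nth: "(\<Sum>i<n. f (vs ! i)) = (\<Sum>v\<in>pverts G. f v)" for f :: "'a \<Rightarrow> real"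
    by (rule sum.reindex_bij_betw[OF bij])
  have sym: "?S $$ (i, j) = ?S $$ (j, i)" if "i < n" "j < n" for i j
    using that D(3) by (auto simp: entry seidel_def)
  have rows: "(\<Sum>j<n. ?S $$ (i, j)) = 0" if "i < n" for i
    using that sum_nth[of "seidel G (vs ! i)"] sum_seidel_row[OF G nth[OF that]] n card
    by (simp add: entry)
  have entries: "(?S $$ (i, j))\<^sup>2 = (if i = j then 0 else 1)" if "i < n" "j < n" for i j
    using that vs' len by (simp add: entry seidel_def nth_eq_iff_index_eq)
  have "0 < n" using n by simp
  obtain E where
    E: "eigenvalues ?S = add_mset 0 E" "size E = n - 1"
      "(\<Sum>x\<in>#E. x\<^sup>2) = real (n - 1) * real n" and
    defect: "(\<Sum>x\<in>#E. (x\<^sup>2 - real n)\<^sup>2) =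
      (\<Sum>i<n. \<Sum>j<n. ((\<Sum>k<n. ?S $$ (i, k) * ?S $$ (j, k)) - (if i = j then real n - 1 else - 1))\<^sup>2)"
    by (rule nontrivial_eigenvalues_moments[OF S \<open>0 < n\<close> sym rows entries])
  have energy: "energy p ?S = (\<Sum>x\<in>#E. \<bar>x\<bar> powr p)" by (simp add: energy_def E(1))
  have size: "real (size E) = real n - 1" using n E(2) by (simp add: of_nat_diff)
  have sq: "(\<Sum>x\<in>#E. x\<^sup>2) = real (size E) * real n" using E(2,3) by simp
  note mean = power_mean_mset[OF p _ sq, folded energy, unfolded size]
  show "(real n - 1) * real n powr (p / 2) \<le> energy p ?S" using mean(1) n by simp
  have diag: "(\<Sum>k<n. ?S $$ (i, k) * ?S $$ (i, k)) = real n - 1" if "i < n" for i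
  proof -
    have "(\<Sum>k<n. ?S $$ (i, k) * ?S $$ (i, k)) = (\<Sum>k<n. 1 - of_bool (k = i))"
      using that entries by (intro sum.cong) (auto simp: power2_eq_square)
    also have "\<dots> = real n - 1" using that by (simp add: sum_subtractf of_bool_def)
    finally show ?thesis .
  qed
  have product: "(\<Sum>k<n. ?S $$ (i, k) * ?S $$ (j, k)) =
      (\<Sum>w\<in>pverts G. seidel G (vs ! i) w * seidel G (vs ! j) w)" if "i < n" "j < n" for i j
    using that sum_nth[of "\<lambda>w. seidel G (vs ! i) w * seidel G (vs ! j) w"] by (simp add: entry)
  have "energy p ?S = (real n - 1) * real n powr (p / 2) \<longleftrightarrow> (\<forall>x\<in>#E. x\<^sup>2 = real n)"
    using mean(2) n by simp
  also have "\<dots> \<longleftrightarrow> (\<Sum>x\<in>#E. (x\<^sup>2 - real n)\<^sup>2) = 0"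
    by (subst sum_mset_nonneg(2)) auto
  also have "\<dots> \<longleftrightarrow> (\<forall>i<n. \<forall>j<n. (\<Sum>k<n. ?S $$ (i, k) * ?S $$ (j, k)) =
      (if i = j then real n - 1 else - 1))"
    unfolding defect by (simp add: sum_nonneg_eq_0_iff sum_nonneg Ball_def)
  also have "\<dots> \<longleftrightarrow> (\<forall>i<n. \<forall>j<n. i \<noteq> j \<longrightarrow>
      (\<Sum>w\<in>pverts G. seidel G (vs ! i) w * seidel G (vs ! j) w) = - 1)"
    by (auto simp: diag simp flip: product)
  also have "\<dots> \<longleftrightarrow> orthogonal_seidel_rows G"
  proof -
    have index: "(\<forall>v\<in>pverts G. P v) \<longleftrightarrow> (\<forall>i<n. P (vs ! i))" for P
      unfolding vs'(2)[symmetric] len[symmetric] by (rule all_set_conv_all_nth)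
    show ?thesis
      unfolding orthogonal_seidel_rows_def index
      using nth_eq_iff_index_eq[OF vs'(1)] by (auto simp: len)
  qed
  finally show "energy p ?S = (real n - 1) * real n powr (p / 2) \<longleftrightarrow> orthogonal_seidel_rows G" .
qed

section \<open>The quadratic character of a finite field and Paley graphs\<close>

context field
begin

definition quadratic_character :: "'a \<Rightarrow> real" where
  "quadratic_character x =
     (if x = \<zero> then 0 else if \<exists>z\<in>carrier R. x = z \<otimes> z then 1 else - 1)"

lemma quadratic_character_zero [simp]: "quadratic_character \<zero> = 0"
  by (simp add: quadratic_character_def)

lemma quadratic_character_square:
  assumes "z \<in> carrier R" "z \<noteq> \<zero>"
  shows "quadratic_character (z \<otimes> z) = 1"
  using assms by (auto simp: quadratic_character_def integral_iff)

text \<open>The multiplicative group is cyclic of even order, so the parity of an exponent of a generator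
  \<open>g\<close> is determined by the element. Hence the squares are the even powers, and multiplicativity,
  the vanishing sum and the value at \<open>- 1\<close> become statements about exponents of \<open>g\<close>.\<close>

lemma odd_field_generator:
  assumes fin: "finite (carrier R)" and odd: "odd (card (carrier R))"
  obtains g where "g \<in> carrier R" "g \<noteq> \<zero>"
    "\<And>x. x \<in> carrier R \<Longrightarrow> x \<noteq> \<zero> \<Longrightarrow> \<exists>i::nat. x = g [^] i"
    "\<And>i::nat. g [^] i = \<one> \<longleftrightarrow> card (carrier R) - 1 dvd i"
    "\<And>i::nat. quadratic_character (g [^] i) = (- 1) ^ i"
proof -
  interpret G: group "mult_of R" by (rule field_mult_group)
  have finG: "finite (carrier (mult_of R))" using fin by simp
  from finite_field_mult_group_has_gen[OF fin] obtain g where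
    g: "g \<in> carrier (mult_of R)" and gen: "carrier (mult_of R) = {g [^] i | i::nat. i \<in> UNIV}"
    by blast
  have card: "card (carrier (mult_of R)) = card (carrier R) - 1" using fin by simp
  have ord_pos: "G.ord g > 0" using G.ord_ge_1[OF finG g] by simp
  (* A generator has full order: it has only ord g distinct powers. *)
  have "carrier (mult_of R) = (\<lambda>i. g [^]\<^bsub>mult_of R\<^esub> i) ` {0..G.ord g - 1}"
    using G.ord_elems[OF finG g] gen by (auto simp: nat_pow_mult_of)
  then have "card (carrier (mult_of R)) \<le> card {0..G.ord g - 1}"
    by (metis card_image_le finite_atLeastAtMost)
  then have "card (carrier R) - 1 \<le> G.ord g" using card ord_pos by simp
  moreover have "G.ord g \<le> card (carrier R) - 1"
    using G.ord_le_group_order[OF finG g] card by (simp add: order_def)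
  ultimately have ord: "G.ord g = card (carrier R) - 1" by simp
  have one: "g [^] i = \<one> \<longleftrightarrow> card (carrier R) - 1 dvd i" for i :: nat
    using G.pow_eq_id[OF g, of i] by (simp add: ord nat_pow_mult_of)
  have gR: "g \<in> carrier R" "g \<noteq> \<zero>" using g by auto
  have nz: "g [^] i \<noteq> \<zero>" for i :: nat
    using G.nat_pow_closed[OF g, of i] by (simp add: nat_pow_mult_of)
  have ev: "even (card (carrier R) - 1)" using odd by simp
  have parity: "even i \<longleftrightarrow> even j" if eq: "g [^] i = g [^] j" for i j :: nat
  proof -
    have *: "even i \<longleftrightarrow> even j" if "i \<le> j" "g [^] i = g [^] j" for i j :: nat
    proof -
      have "g [^] i \<otimes> g [^] (j - i) = g [^] i \<otimes> \<one>"
        using that gR by (subst nat_pow_mult) simp_all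
      then have "g [^] (j - i) = \<one>"
        using gR nz[of i] m_lcancel[of "g [^] i" "g [^] (j - i)" \<one>] by simp
      then have "even (j - i)" using one ev dvd_trans by blast
      then show ?thesis using that(1) by simp
    qed
    show ?thesis using *[OF _ eq] *[OF _ eq[symmetric]] nat_le_linear[of i j] by blast
  qed
  have gens: "\<exists>i::nat. x = g [^] i" if "x \<in> carrier R" "x \<noteq> \<zero>" for x
  proof -
    have "x \<in> carrier (mult_of R)" using that by simp
    then show ?thesis unfolding gen by blast
  qed
  have char: "quadratic_character (g [^] i) = (- 1) ^ i" for i :: nat
  proof (cases "even i")
    case True
    then obtain j where "i = j + j" by (metis evenE mult_2)
    then have "g [^] i = g [^] j \<otimes> g [^] j" using gR by (simp add: nat_pow_mult)
    then show ?thesis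
      using True gR quadratic_character_square[of "g [^] j"] by (simp add: nz)
  next
    case False
    have "g [^] i \<noteq> z \<otimes> z" if z: "z \<in> carrier R" for z
    proof
      assume eq: "g [^] i = z \<otimes> z"
      then have "z \<noteq> \<zero>" using nz[of i] by auto
      then obtain j :: nat where "z = g [^] j" using gens z by blast
      then have "g [^] i = g [^] (j + j)" using eq gR by (simp add: nat_pow_mult)
      then have "even i \<longleftrightarrow> even (j + j)" by (rule parity)
      with False show False by simp
    qed
    then show ?thesis using False gR by (auto simp: quadratic_character_def nz)
  qed
  show ?thesis by (rule that) (fact gR gens one char)+
qed

lemma quadratic_character_mult:
  assumes fin: "finite (carrier R)" and odd: "odd (card (carrier R))"
    and xy: "x \<in> carrier R" "y \<in> carrier R"
  shows "quadratic_character (x \<otimes> y) = quadratic_character x * quadratic_character y"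
proof (cases "x = \<zero> \<or> y = \<zero>")
  case True
  then show ?thesis using xy by auto
next
  case False
  obtain g where g: "g \<in> carrier R"
      "\<And>x. x \<in> carrier R \<Longrightarrow> x \<noteq> \<zero> \<Longrightarrow> \<exists>i::nat. x = g [^] i"
      "\<And>i::nat. quadratic_character (g [^] i) = (- 1) ^ i"
    using odd_field_generator[OF fin odd] by metis
  obtain i j :: nat where "x = g [^] i" "y = g [^] j" using g(2) False xy by metis
  then show ?thesis using g(1) by (simp add: nat_pow_mult g(3) power_add)
qed

text \<open>Multiplication by the generator permutes the field and changes the sign of the character.\<close>

lemma sum_quadratic_character:
  assumes fin: "finite (carrier R)" and odd: "odd (card (carrier R))"
  shows "(\<Sum>x\<in>carrier R. quadratic_character x) = 0"
proof -
  obtain g where g: "g \<in> carrier R" "g \<noteq> \<zero>"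
      "\<And>i::nat. quadratic_character (g [^] i) = (- 1) ^ i"
    using odd_field_generator[OF fin odd] by metis
  have neg: "quadratic_character g = - 1" using g(1) g(3)[of 1] by simp
  have "(\<Sum>x\<in>carrier R. quadratic_character x) = (\<Sum>x\<in>carrier R. quadratic_character (g \<otimes> x))"
    using g by (intro sum.reindex_bij_witness[of _ "\<lambda>x. g \<otimes> x" "\<lambda>x. inv g \<otimes> x"])
      (auto simp: field_Units m_assoc[symmetric])
  also have "\<dots> = - (\<Sum>x\<in>carrier R. quadratic_character x)"
    using g(1) by (simp add: quadratic_character_mult[OF fin odd] neg sum_negf)
  finally show ?thesis by simp
qed

text \<open>If \<open>- 1 = g\<^sup>i\<close>, then \<open>g\<^bsup>2 i\<^esup> = 1\<close>, so \<open>2 i\<close> is a multiple of the group order and hence of \<open>4\<close>.\<close>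

lemma quadratic_character_minus_one:
  assumes fin: "finite (carrier R)" and n: "card (carrier R) mod 4 = 1"
  shows "quadratic_character (\<ominus> \<one>) = 1"
proof -
  have odd: "odd (card (carrier R))" using n by presburger
  obtain g where g: "g \<in> carrier R"
      "\<And>x. x \<in> carrier R \<Longrightarrow> x \<noteq> \<zero> \<Longrightarrow> \<exists>i::nat. x = g [^] i"
      "\<And>i::nat. g [^] i = \<one> \<longleftrightarrow> card (carrier R) - 1 dvd i"
      "\<And>i::nat. quadratic_character (g [^] i) = (- 1) ^ i"
    using odd_field_generator[OF fin odd] by metis
  have "\<ominus> \<one> \<noteq> \<zero>" by (metis a_inv_closed minus_minus minus_zero one_closed one_not_zero)
  then obtain i :: nat where i: "\<ominus> \<one> = g [^] i" using g(2)[of "\<ominus> \<one>"] by auto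
  have "g [^] (i + i) = \<one>" using g(1) by (simp flip: nat_pow_mult i) (simp add: l_minus)
  then have "card (carrier R) - 1 dvd i + i" using g(3) by blast
  moreover have "4 dvd card (carrier R) - 1" using n by presburger
  ultimately have "4 dvd i + i" by (rule dvd_trans[rotated])
  then have "even i" by presburger
  then show ?thesis by (simp add: i g(4))
qed

text \<open>For \<open>w \<noteq> 0\<close> we have \<open>w (w + c) = w\<^sup>2 (1 + c / w)\<close>, so the summand is the character of
  \<open>1 + c / w\<close>, which runs through all elements of the field except \<open>1\<close>.\<close>

lemma sum_quadratic_character_shift:
  assumes fin: "finite (carrier R)" and odd: "odd (card (carrier R))"
    and c: "c \<in> carrier R" "c \<noteq> \<zero>"
  shows "(\<Sum>w\<in>carrier R. quadratic_character w * quadratic_character (w \<oplus> c)) = - 1"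
proof -
  note mult = quadratic_character_mult[OF fin odd]
  have inv[simp]: "inv w \<in> carrier R" "inv w \<noteq> \<zero>" "w \<otimes> inv w = \<one>" "inv w \<otimes> w = \<one>"
    if "w \<in> carrier R" "w \<noteq> \<zero>" for w
  proof -
    show *: "inv w \<in> carrier R" "w \<otimes> inv w = \<one>" "inv w \<otimes> w = \<one>"
      using that by (auto simp: field_Units)
    then show "inv w \<noteq> \<zero>" using that(1) by auto
  qed
  have "(\<Sum>w\<in>carrier R. quadratic_character w * quadratic_character (w \<oplus> c)) =
      (\<Sum>w\<in>carrier R - {\<zero>}. quadratic_character w * quadratic_character (w \<oplus> c))"
    using fin by (intro sum.mono_neutral_right) auto
  also have "\<dots> = (\<Sum>w\<in>carrier R - {\<zero>}. quadratic_character (\<one> \<oplus> c \<otimes> inv w))"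
  proof (rule sum.cong[OF refl])
    fix w assume "w \<in> carrier R - {\<zero>}"
    then have w: "w \<in> carrier R" "w \<noteq> \<zero>" by auto
    have "w \<oplus> c = w \<otimes> (\<one> \<oplus> c \<otimes> inv w)"
      using w c inv(3)[OF w] by (simp add: r_distr m_lcomm)
    then have "quadratic_character w * quadratic_character (w \<oplus> c) =
        quadratic_character (w \<otimes> w) * quadratic_character (\<one> \<oplus> c \<otimes> inv w)"
      using w c by (simp add: mult)
    then show "quadratic_character w * quadratic_character (w \<oplus> c) =
        quadratic_character (\<one> \<oplus> c \<otimes> inv w)"
      using quadratic_character_square[OF w] by simp
  qed
  also have "\<dots> = (\<Sum>y\<in>carrier R - {\<one>}. quadratic_character y)"
  proof (rule sum.reindex_bij_betw)
    let ?f = "\<lambda>w. \<one> \<oplus> c \<otimes> inv w"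
    have "inj_on ?f (carrier R - {\<zero>})"
    proof (rule inj_onI)
      fix w w' assume w: "w \<in> carrier R - {\<zero>}" "w' \<in> carrier R - {\<zero>}" and "?f w = ?f w'"
      then have "inv w = inv w'" using c by (simp add: m_lcancel)
      then show "w = w'" using w by (metis DiffD1 DiffD2 Units_inv_inv field_Units singletonI DiffI)
    qed
    moreover have "?f ` (carrier R - {\<zero>}) \<subseteq> carrier R - {\<one>}"
    proof (rule image_subsetI)
      fix w assume "w \<in> carrier R - {\<zero>}"
      then have w: "w \<in> carrier R" "w \<noteq> \<zero>" by auto
      then have "c \<otimes> inv w \<noteq> \<zero>" using c by (simp add: integral_iff)
      then have "?f w \<noteq> \<one>" using c w by simp
      then show "?f w \<in> carrier R - {\<one>}" using c w by simp
    qed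
    ultimately show "bij_betw ?f (carrier R - {\<zero>}) (carrier R - {\<one>})"
      using fin by (simp add: bij_betw_def card_image card_subset_eq)
  qed
  also have "\<dots> = (\<Sum>y\<in>carrier R. quadratic_character y) - quadratic_character \<one>"
    using fin by (simp add: sum_diff1)
  also have "\<dots> = - 1"
    using quadratic_character_square[of \<one>] by (simp add: sum_quadratic_character[OF fin odd])
  finally show ?thesis .
qed

lemma seidel_paley_graph:
  assumes "u \<in> carrier R" "v \<in> carrier R"
  shows "seidel (paley_graph R) u v = - quadratic_character (u \<ominus> v)"
  using assms by (auto simp: seidel_def paley_graph_def quadratic_character_def)

lemma sum_reflect:
  assumes "u \<in> carrier R"
  shows "(\<Sum>w\<in>carrier R. f (u \<ominus> w)) = (\<Sum>w\<in>carrier R. f w)"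
proof -
  have "u \<ominus> (u \<ominus> w) = w" if "w \<in> carrier R" for w using assms that by algebra
  then show ?thesis
    using assms by (intro sum.reindex_bij_witness[of _ "\<lambda>w. u \<ominus> w" "\<lambda>w. u \<ominus> w"]) auto
qed

lemma card_nonzero_squares:
  assumes fin: "finite (carrier R)" and odd: "odd (card (carrier R))"
  shows "card {x \<in> carrier R. quadratic_character x = 1} = (card (carrier R) - 1) div 2"
proof -
  let ?Q = "{x \<in> carrier R. quadratic_character x = 1}"
  have pos: "0 < card (carrier R)" using odd by (simp add: odd_pos)
  have "2 * real (card ?Q) = (\<Sum>x\<in>carrier R. 2 * of_bool (quadratic_character x = 1))"
    using fin by (simp add: Int_def flip: sum_distrib_left)
  (* The values 1, - 1 and 0 of the character contribute 2, 0 and 0. *)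
  also have "\<dots> = (\<Sum>x\<in>carrier R. quadratic_character x + of_bool (x \<noteq> \<zero>))"
    by (intro sum.cong) (auto simp: quadratic_character_def)
  also have "\<dots> = (\<Sum>x\<in>carrier R. of_bool (x \<noteq> \<zero>))"
    by (simp add: sum.distrib sum_quadratic_character[OF fin odd])
  also have "\<dots> = real (card (carrier R - {\<zero>}))"
    using fin by (simp add: Int_def set_diff_eq)
  also have "\<dots> = real (card (carrier R) - 1)" using fin by simp
  finally show ?thesis by linarith
qed

text \<open>Adjacency is symmetric because \<open>- 1\<close> is a square, and a vertex has one neighbour for every nonzero
  square.\<close>

lemma paley_graph_regular:
  assumes fin: "finite (carrier R)" and n: "card (carrier R) mod 4 = 1" "5 \<le> card (carrier R)"
  shows "regular_graph (paley_graph R) ((card (carrier R) - 1) div 2)"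
proof -
  let ?G = "paley_graph R"
  have odd: "odd (card (carrier R))" using n by presburger
  have verts: "pverts ?G = carrier R" by (simp add: paley_graph_def)
  have arcs: "(x, y) \<in> parcs ?G \<longleftrightarrow> x \<in> carrier R \<and> y \<in> carrier R \<and> quadratic_character (x \<ominus> y) = 1"
    for x y by (auto simp: paley_graph_def quadratic_character_def a_minus_def r_neg)
  have sym: "quadratic_character (y \<ominus> x) = quadratic_character (x \<ominus> y)"
    if xy: "x \<in> carrier R" "y \<in> carrier R" for x y
  proof -
    have "y \<ominus> x = \<ominus> \<one> \<otimes> (x \<ominus> y)" using xy by algebra
    then show ?thesis
      using xy by (simp add: quadratic_character_mult[OF fin odd] quadratic_character_minus_one[OF fin n(1)])
  qed
  have "parcs ?G \<subseteq> carrier R \<times> carrier R" by (auto simp: paley_graph_def)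
  then have fin_arcs: "finite (parcs ?G)" using fin by (meson finite_SigmaI finite_subset)
  interpret pair_graph ?G
  proof
    show "symmetric (with_proj ?G)"
      by (auto simp: symmetric_def arcs sym intro: symI)
  qed (use fin fin_arcs in \<open>auto simp: paley_graph_def\<close>)
  have degree: "out_degree (with_proj ?G) v = (card (carrier R) - 1) div 2" if v: "v \<in> carrier R" for v
  proof -
    have "card {w \<in> carrier R. quadratic_character (v \<ominus> w) = 1}
        = (\<Sum>w\<in>carrier R. of_bool (quadratic_character (v \<ominus> w) = 1))"
      using fin by (simp add: Int_def)
    also have "\<dots> = (\<Sum>w\<in>carrier R. of_bool (quadratic_character w = 1))"
      by (rule sum_reflect[OF v])
    also have "\<dots> = card {w \<in> carrier R. quadratic_character w = 1}"
      using fin by (simp add: Int_def)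
    finally show ?thesis
      using v by (simp add: out_degree_eq_card_neighbours verts arcs card_nonzero_squares[OF fin odd])
  qed
  have "(\<one>, \<zero>) \<in> parcs ?G"
    using quadratic_character_square[of \<one>] by (simp add: arcs a_minus_def)
  then have "simple_graph ?G" by unfold_locales auto
  then show ?thesis using degree by (simp add: regular_graph_def verts)
qed

text \<open>Substituting \<open>u - w\<close> for \<open>w\<close> turns the inner product of the rows of \<open>u\<close> and \<open>v\<close> into the shifted
  character sum with \<open>c = v - u\<close>.\<close>

lemma orthogonal_seidel_rows_paley_graph:
  assumes fin: "finite (carrier R)" and odd: "odd (card (carrier R))"
  shows "orthogonal_seidel_rows (paley_graph R)"
  unfolding orthogonal_seidel_rows_def
proof (intro ballI impI)
  fix u v assume "u \<in> pverts (paley_graph R)" "v \<in> pverts (paley_graph R)" and "u \<noteq> v"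
  then have uv: "u \<in> carrier R" "v \<in> carrier R" by (auto simp: paley_graph_def)
  have c: "v \<ominus> u \<in> carrier R" "v \<ominus> u \<noteq> \<zero>"
    using uv \<open>u \<noteq> v\<close> by auto
  have shift: "v \<ominus> w = (u \<ominus> w) \<oplus> (v \<ominus> u)" if "w \<in> carrier R" for w
    using uv that by algebra
  have "(\<Sum>w\<in>pverts (paley_graph R). seidel (paley_graph R) u w * seidel (paley_graph R) v w)
      = (\<Sum>w\<in>carrier R. quadratic_character (u \<ominus> w) * quadratic_character ((u \<ominus> w) \<oplus> (v \<ominus> u)))"
    using uv by (intro sum.cong) (auto simp: paley_graph_def[THEN arg_cong[where f = pverts]]
      seidel_paley_graph simp flip: shift)
  also have "\<dots> = (\<Sum>w\<in>carrier R. quadratic_character w * quadratic_character (w \<oplus> (v \<ominus> u)))"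
    by (rule sum_reflect[OF uv(1)])
  also have "\<dots> = - 1" by (rule sum_quadratic_character_shift[OF fin odd c])
  finally show "(\<Sum>w\<in>pverts (paley_graph R). seidel (paley_graph R) u w * seidel (paley_graph R) v w) = - 1" .
qed

end

theorem theorem3p9:
  fixes n r :: nat
  assumes "n \<ge> 5" and "n mod 4 = 1" and "r = (n - 1) div 2"
  shows "(\<forall>(G :: 'a pair_pre_digraph) vs (p :: real).
            regular_graph G r \<and> card (pverts G) = n \<and> vertex_enumeration G vs \<and> p > 2 \<longrightarrow>
              energy p (seidel_matrix G vs) \<ge> (real n - 1) * real n powr (p / 2) \<and>
              (energy p (seidel_matrix G vs) = (real n - 1) * real n powr (p / 2)
                 \<longleftrightarrow> conference_graph G n)) \<and>
         (\<forall>F :: 'c ring.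
            primepow n \<and> field F \<and> card (carrier F) = n \<longrightarrow>
              regular_graph (paley_graph F) r \<and>
              (\<forall>vs (p :: real). vertex_enumeration (paley_graph F) vs \<and> p > 2 \<longrightarrow>
                 energy p (seidel_matrix (paley_graph F) vs) = (real n - 1) * real n powr (p / 2)))"
proof (intro conjI allI impI)
  have n: "n = 2 * r + 1" "1 < n" using assms by presburger+
  {
    fix G :: "'a pair_pre_digraph" and vs and p :: real
    assume "regular_graph G r \<and> card (pverts G) = n \<and> vertex_enumeration G vs \<and> p > 2"
    then have G: "regular_graph G r" "card (pverts G) = n" "vertex_enumeration G vs" "2 < p" by auto
    note bound = seidel_energy_bound[OF G(1,2) n G(3,4)]
    show "(real n - 1) * real n powr (p / 2) \<le> energy p (seidel_matrix G vs)" by (rule bound(1))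
    show "energy p (seidel_matrix G vs) = (real n - 1) * real n powr (p / 2) \<longleftrightarrow> conference_graph G n"
      using bound(2) conference_graph_iff_orthogonal_seidel_rows[OF G(1,2) n(1) assms(2,1)] by simp
  next
    fix F :: "'c ring"
    assume "primepow n \<and> field F \<and> card (carrier F) = n"
    then have F: "field F" and card: "card (carrier F) = n" by auto
    interpret field F by (rule F)
    have fin: "finite (carrier F)" using card n by (metis card.infinite not_less_zero)
    show regular: "regular_graph (paley_graph F) r"
      using paley_graph_regular[OF fin] card assms by simp
    fix vs and p :: real
    assume "vertex_enumeration (paley_graph F) vs \<and> p > 2"
    then have vs: "vertex_enumeration (paley_graph F) vs" and p: "2 < p" by auto
    have "card (pverts (paley_graph F)) = n" by (simp add: paley_graph_def card)
    from seidel_energy_bound(2)[OF regular this n vs p]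
    show "energy p (seidel_matrix (paley_graph F) vs) = (real n - 1) * real n powr (p / 2)"
      using orthogonal_seidel_rows_paley_graph[OF fin] card n by simp
  }
qed

end
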